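(* Let $(X,d)$ be a compact metric space and let $T:X\to X$ be an open expanding map. Let $\alpha\in(0,1]$. For any $\alpha$-Hölder function $f:X\to\mathbb{R}$ there exists an $\alpha$-Hölder function $v:X\to\mathbb{R}$ such that $$f(x)+v(x)-v(T(x))\le\beta(X,T,f)\quad\text{for all }x\in X.$$
   Context: An open expanding map $T:X\to X$ is a continuous map such that $T(A)$ is open in $X$ for every open $A\subseteq X$, and such that there exist $\lambda>1$, $\eta>0$ with $d(T(x),T(y))\ge\lambda d(x,y)$ whenever $x,y\in X$ satisfy $d(x,y)\le\eta$. (It is not assumed that $X$ is connected, that $T$ is surjective or that $T$ is transitive.) The maximum ergodic average is $\beta(X,T,f)=\sup\{\int f\,d\mu:\mu\text{ a }T\text{-invariant Borel probability measure on }X\}$. A function $g:X\to\mathbb{R}$ is $\alpha$-Hölder if there is $K>0$ with $|g(z)-g(z')|\le K d(z,z')^\alpha$ for all $z,z'\in X$. *)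

theory Defs
  imports "HOL-Analysis.Analysis" "HOL-Probability.Probability"
begin

text \<open>
  A metric space is modelled as a subset \<open>X\<close> of a type of class \<open>metric_space\<close>, with the metric
  and topology inherited from the type. Maps on \<open>X\<close> are total functions on the type of which only
  the values on \<open>X\<close> matter.
\<close>

definition open_expanding_map :: "'a::metric_space set \<Rightarrow> ('a \<Rightarrow> 'a) \<Rightarrow> bool" where
  "open_expanding_map X T \<longleftrightarrow>
     T ` X \<subseteq> X \<and>
     continuous_on X T \<and>
     open_map (top_of_set X) (top_of_set X) T \<and>
     (\<exists>l>1. \<exists>\<eta>>0. \<forall>x\<in>X. \<forall>y\<in>X. dist x y \<le> \<eta> \<longrightarrow> dist (T x) (T y) \<ge> l * dist x y)"

definition holder_on :: "real \<Rightarrow> 'a::metric_space set \<Rightarrow> ('a \<Rightarrow> real) \<Rightarrow> bool" where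
  "holder_on \<alpha> X g \<longleftrightarrow>
     (\<exists>K>0. \<forall>z\<in>X. \<forall>z'\<in>X. \<bar>g z - g z'\<bar> \<le> K * dist z z' powr \<alpha>)"

definition invariant_prob_measures :: "'a::metric_space set \<Rightarrow> ('a \<Rightarrow> 'a) \<Rightarrow> 'a measure set" where
  "invariant_prob_measures X T =
     {M. prob_space M \<and> sets M = sets (restrict_space borel X) \<and>
         T \<in> M \<rightarrow>\<^sub>M M \<and> distr M M T = M}"

text \<open>
  For nonempty compact \<open>X\<close> and continuous \<open>T\<close> and \<open>f\<close>, the supremum is that of a nonempty
  bounded set of reals; for empty \<open>X\<close> there are no invariant probability measures and the value
  carries no meaning.
\<close>

definition max_ergodic_average :: "'a::metric_space set \<Rightarrow> ('a \<Rightarrow> 'a) \<Rightarrow> ('a \<Rightarrow> real) \<Rightarrow> real" where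
  "max_ergodic_average X T f = (SUP M\<in>invariant_prob_measures X T. integral\<^sup>L M f)"

end

theory Submission imports Defs begin

text \<open>
  Write \<open>\<beta>\<close> for the maximum ergodic average and \<open>g = f - \<beta>\<close>. The function sought is
  \<open>v x = sup {S\<^sub>n g y | T\<^sup>n y = x, n \<ge> 0}\<close>, where \<open>S\<^sub>n g\<close> denotes the \<open>n\<close>-th Birkhoff sum.
  Prolonging by one step an orbit segment that ends at \<open>x\<close> gives one that ends at \<open>T x\<close>, so
  \<open>v (T x) \<ge> v x + g x\<close> as soon as the suprema are finite.

  The map \<open>T\<close> has inverse branches on balls of a uniform radius, and they contract. An orbit
  segment that ends at \<open>x\<close> can thus be moved to one that ends at a nearby point \<open>x'\<close>, and the
  Birkhoff sums along the two differ by a convergent geometric series of order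
  \<open>d(x, x')\<^sup>\<alpha>\<close>; hence \<open>v\<close> inherits the Hoelder exponent (lemma
  \<open>bounded_birkhoff_sums_imp_holder_subaction\<close>). Using all preimages of \<open>x\<close> under all iterates,
  with \<open>n = 0\<close> included, keeps the supremum over a nonempty set even where \<open>T\<close> is not surjective.

  What remains is an upper bound for \<open>S\<^sub>n g\<close> that does not depend on \<open>n\<close> (lemma
  \<open>birkhoff_sums_bounded_above\<close>). The closing lemma shadows a segment that nearly returns to its
  start by a periodic orbit. The Birkhoff sum of \<open>g\<close> over a periodic orbit is at most \<open>0\<close>, because
  the orbit carries an invariant measure, so the sum over a near return is bounded by a constant.
  After covering \<open>X\<close> by finitely many cells so small that two visits to the same cell make a near
  return, any segment splits into at most one near return and one further step for each cell
  (lemma \<open>birkhoff_sum_le_card_cells\<close>).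
\<close>

section \<open>Birkhoff sums\<close>

definition birkhoff_sum :: "('a \<Rightarrow> 'a) \<Rightarrow> ('a \<Rightarrow> real) \<Rightarrow> nat \<Rightarrow> 'a \<Rightarrow> real" where
  "birkhoff_sum T g n x = (\<Sum>k<n. g ((T ^^ k) x))"

lemma birkhoff_sum_0 [simp]: "birkhoff_sum T g 0 x = 0"
  by (simp add: birkhoff_sum_def)

lemma birkhoff_sum_Suc: "birkhoff_sum T g (Suc n) x = birkhoff_sum T g n x + g ((T ^^ n) x)"
  by (simp add: birkhoff_sum_def)

lemma birkhoff_sum_add:
  "birkhoff_sum T g (m + n) x = birkhoff_sum T g m x + birkhoff_sum T g n ((T ^^ m) x)"
proof (induction n)
  case (Suc n)
  have "(T ^^ (m + n)) x = (T ^^ n) ((T ^^ m) x)"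
    by (metis add.commute comp_apply funpow_add)
  then show ?case using Suc by (simp add: birkhoff_sum_Suc)
qed simp

lemma birkhoff_sum_diff_const:
  "birkhoff_sum T (\<lambda>x. g x - c) n x = birkhoff_sum T g n x - real n * c"
  by (simp add: birkhoff_sum_def sum_subtractf)

lemma funpow_in_invariant_set: "T ` X \<subseteq> X \<Longrightarrow> x \<in> X \<Longrightarrow> (T ^^ n) x \<in> X"
  by (induction n) auto

text \<open>
  An orbit segment that starts in a cell \<open>U\<close> splits at its last visit to \<open>U\<close>. The part before that
  visit is a return to \<open>U\<close>, so it contributes at most \<open>C\<close>; the visit itself contributes at most
  \<open>B\<close>; the rest avoids \<open>U\<close>. Each cell is thus used up once, whatever the length of the segment.
\<close>
lemma birkhoff_sum_le_card_cells:
  fixes B C :: real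
  assumes inv: "T ` X \<subseteq> X"
    and B: "B \<ge> 0" "\<And>x. x \<in> X \<Longrightarrow> g x \<le> B"
    and C: "C \<ge> 0"
    and fin: "finite \<U>"
    and ret: "\<And>U x m. U \<in> \<U> \<Longrightarrow> x \<in> X \<Longrightarrow> x \<in> U \<Longrightarrow> (T ^^ m) x \<in> U \<Longrightarrow> m > 0 \<Longrightarrow>
        birkhoff_sum T g m x \<le> C"
    and x: "x \<in> X" and orb: "\<And>k. k < n \<Longrightarrow> (T ^^ k) x \<in> \<Union>\<U>"
  shows "birkhoff_sum T g n x \<le> real (card \<U>) * (C + B)"
  using fin ret x orb
proof (induction \<U> arbitrary: n x rule: finite_psubset_induct)
  case (psubset \<U>)
  show ?case
  proof (cases "n = 0")
    case True
    then show ?thesis using B C by simp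
  next
    case False
    then have "x \<in> \<Union>\<U>" using psubset.prems(3)[of 0] by simp
    then obtain U where U: "U \<in> \<U>" "x \<in> U" by blast
    define J where "J = {k. k < n \<and> (T ^^ k) x \<in> U}"
    define j where "j = Max J"
    have finJ: "finite J" by (simp add: J_def)
    have "0 \<in> J" using False U by (simp add: J_def)
    then have "j \<in> J" unfolding j_def using finJ by (intro Max_in) auto
    then have j: "j < n" "(T ^^ j) x \<in> U" by (auto simp: J_def)
    have last: "(T ^^ k) x \<notin> U" if "j < k" "k < n" for k
    proof
      assume "(T ^^ k) x \<in> U"
      then have "k \<in> J" using that by (simp add: J_def)
      then show False using Max_ge[OF finJ] that(1) by (simp add: j_def leD)
    qed
    define y where "y = (T ^^ Suc j) x"
    have y: "y \<in> X" unfolding y_def using inv psubset.prems(2) by (rule funpow_in_invariant_set)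
    have iter: "(T ^^ k) y = (T ^^ (Suc j + k)) x" for k
      unfolding y_def by (metis add.commute comp_apply funpow_add)
    have rest: "birkhoff_sum T g (n - Suc j) y \<le> real (card (\<U> - {U})) * (C + B)"
    proof (rule psubset.IH)
      show "\<U> - {U} \<subset> \<U>" using U by blast
      show "birkhoff_sum T g m z \<le> C" if "V \<in> \<U> - {U}" "z \<in> X" "z \<in> V" "(T ^^ m) z \<in> V" "m > 0"
        for V z m using that psubset.prems(1) by blast
      show "(T ^^ k) y \<in> \<Union>(\<U> - {U})" if "k < n - Suc j" for k
      proof -
        have "Suc j + k < n" using that by simp
        then have "(T ^^ (Suc j + k)) x \<in> \<Union>\<U>" "(T ^^ (Suc j + k)) x \<notin> U"
          by (rule psubset.prems(3), rule last[rotated]) simp_all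
        then show ?thesis unfolding iter by blast
      qed
    qed (rule y)
    have first: "birkhoff_sum T g j x \<le> C"
      using psubset.prems(1)[OF U(1) psubset.prems(2) U(2) j(2)] C by (cases "j = 0") auto
    have "birkhoff_sum T g n x = birkhoff_sum T g (Suc j) x + birkhoff_sum T g (n - Suc j) y"
      using birkhoff_sum_add[of T g "Suc j" "n - Suc j" x] j by (simp add: y_def)
    also have "\<dots> \<le> C + B + real (card (\<U> - {U})) * (C + B)"
      using first rest B(2)[OF funpow_in_invariant_set[OF inv psubset.prems(2), of j]]
      by (simp add: birkhoff_sum_Suc)
    also have "\<dots> = (1 + real (card (\<U> - {U}))) * (C + B)" by (simp add: algebra_simps)
    also have "1 + real (card (\<U> - {U})) = real (card \<U>)"
      using card_Suc_Diff1[OF psubset.hyps(1) U(1)] by linarith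
    finally show ?thesis .
  qed
qed

section \<open>Hoelder functions\<close>

lemma holder_on_imp_continuous_on:
  assumes "0 < \<alpha>" and "holder_on \<alpha> X g"
  shows "continuous_on X g"
proof -
  obtain K where K: "\<And>z z'. z \<in> X \<Longrightarrow> z' \<in> X \<Longrightarrow> \<bar>g z - g z'\<bar> \<le> K * dist z z' powr \<alpha>"
    using assms(2) unfolding holder_on_def by blast
  show ?thesis
    unfolding continuous_on
  proof
    fix x assume x: "x \<in> X"
    have "((\<lambda>z. dist z x) \<longlongrightarrow> dist x x) (at x within X)"
      by (intro tendsto_dist tendsto_ident_at tendsto_const)
    then have "((\<lambda>z. dist z x powr \<alpha>) \<longlongrightarrow> 0) (at x within X)"
      by (intro tendsto_zero_powrI[where b = \<alpha>] tendsto_const assms(1)) auto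
    then have "((\<lambda>z. K * dist z x powr \<alpha>) \<longlongrightarrow> 0) (at x within X)"
      using tendsto_mult_right_zero by blast
    then have "((\<lambda>z. g z - g x) \<longlongrightarrow> 0) (at x within X)"
      by (rule Lim_null_comparison[rotated]) (use K x in \<open>auto simp: eventually_at_topological\<close>)
    then show "(g \<longlongrightarrow> g x) (at x within X)" using LIM_zero_iff by blast
  qed
qed

text \<open>
  On a pair of orbits that approach each other geometrically as they run towards their ends, the
  differences of \<open>f\<close> are dominated by a geometric series, so the bound does not depend on the
  length \<open>n\<close>.
\<close>
lemma birkhoff_sum_distortion:
  fixes l K D \<alpha> :: real
  assumes "1 < l" "0 < \<alpha>" "K \<ge> 0" "D \<ge> 0"
    and inv: "T ` X \<subseteq> X" and ab: "a \<in> X" "b \<in> X"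
    and K: "\<And>z z'. z \<in> X \<Longrightarrow> z' \<in> X \<Longrightarrow> \<bar>f z - f z'\<bar> \<le> K * dist z z' powr \<alpha>"
    and near: "\<And>k. k < n \<Longrightarrow> dist ((T ^^ k) a) ((T ^^ k) b) \<le> D / l ^ (n - k)"
  shows "birkhoff_sum T f n a \<le> birkhoff_sum T f n b + K / (1 - l powr (- \<alpha>)) * D powr \<alpha>"
proof -
  define q where "q = l powr (- \<alpha>)"
  have q: "0 < q" "q < 1" using assms(1,2) by (auto simp: q_def powr_less_one)
  have summand: "f ((T ^^ k) a) - f ((T ^^ k) b) \<le> K * D powr \<alpha> * q ^ (n - k)" if "k < n" for k
  proof -
    have "f ((T ^^ k) a) - f ((T ^^ k) b) \<le> K * dist ((T ^^ k) a) ((T ^^ k) b) powr \<alpha>"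
      using K[of "(T ^^ k) a" "(T ^^ k) b"] ab by (simp add: funpow_in_invariant_set[OF inv] abs_le_iff)
    also have "\<dots> \<le> K * (D / l ^ (n - k)) powr \<alpha>"
      using near[OF that] assms(1-4) by (intro mult_left_mono powr_mono2) auto
    also have "(D / l ^ (n - k)) powr \<alpha> = D powr \<alpha> * q ^ (n - k)"
    proof -
      have "(l ^ (n - k)) powr \<alpha> = (l powr \<alpha>) ^ (n - k)"
        using assms(1) by (simp add: powr_powr mult.commute flip: powr_realpow)
      moreover have "q = 1 / l powr \<alpha>" by (simp add: q_def powr_minus_divide)
      moreover have "(D / l ^ (n - k)) powr \<alpha> = D powr \<alpha> / (l ^ (n - k)) powr \<alpha>"
        by (rule powr_divide)
      ultimately show ?thesis by (simp add: power_one_over)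
    qed
    finally show ?thesis by (simp add: mult.assoc)
  qed
  have "(\<Sum>k<n. q ^ (n - k)) \<le> (\<Sum>k<n. q ^ (n - Suc k))"
    by (intro sum_mono power_decreasing) (use q in auto)
  also have "\<dots> = (\<Sum>k<n. q ^ k)" by (rule sum.nat_diff_reindex)
  also have "\<dots> \<le> 1 / (1 - q)"
    using q by (simp add: sum_gp_strict divide_simps)
  finally have geo: "(\<Sum>k<n. q ^ (n - k)) \<le> 1 / (1 - q)" .
  have "birkhoff_sum T f n a - birkhoff_sum T f n b = (\<Sum>k<n. f ((T ^^ k) a) - f ((T ^^ k) b))"
    by (simp add: birkhoff_sum_def sum_subtractf)
  also have "\<dots> \<le> (\<Sum>k<n. K * D powr \<alpha> * q ^ (n - k))"
    by (intro sum_mono) (use summand in auto)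
  also have "\<dots> = K * D powr \<alpha> * (\<Sum>k<n. q ^ (n - k))" by (simp add: sum_distrib_left)
  also have "\<dots> \<le> K * D powr \<alpha> * (1 / (1 - q))"
    using geo assms(3) by (intro mult_left_mono) auto
  finally show ?thesis by (simp add: q_def)
qed

section \<open>Inverse branches and the closing lemma\<close>

text \<open>
  If no \<open>\<delta>\<close> works, the counterexamples \<open>x\<close> accumulate at some \<open>c\<close>, and the corresponding \<open>y\<close>
  tend to \<open>T c\<close>. By openness, the image of the ball of radius \<open>\<eta> / 2\<close> around \<open>c\<close> is a
  neighbourhood of \<open>T c\<close>, so it eventually contains \<open>y\<close>; the ball itself eventually lies within
  distance \<open>\<eta>\<close> of \<open>x\<close>.
\<close>
lemma uniform_local_surjectivity:
  fixes X :: "'a::metric_space set"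
  assumes X: "compact X" and inv: "T ` X \<subseteq> X" and cont: "continuous_on X T"
    and op: "open_map (top_of_set X) (top_of_set X) T" and "\<eta> > 0"
  obtains \<delta> where "\<delta> > 0"
    "\<And>x y. x \<in> X \<Longrightarrow> y \<in> X \<Longrightarrow> dist y (T x) < \<delta> \<Longrightarrow> \<exists>w\<in>X. T w = y \<and> dist w x \<le> \<eta>"
proof (rule ccontr)
  assume neg: "\<not> thesis"
  have "\<exists>x y. x \<in> X \<and> y \<in> X \<and> dist y (T x) < 1 / real (Suc n) \<and> \<not> (\<exists>w\<in>X. T w = y \<and> dist w x \<le> \<eta>)"
    for n
  proof (rule ccontr)
    assume "\<not> ?thesis"
    then have "thesis" by (intro that[of "1 / real (Suc n)"]) auto
    with neg show False ..
  qed
  then obtain x y where xy: "\<And>n. x n \<in> X" "\<And>n. y n \<in> X" "\<And>n. dist (y n) (T (x n)) < 1 / real (Suc n)"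
    and none: "\<And>n w. w \<in> X \<Longrightarrow> T w = y n \<Longrightarrow> dist w (x n) > \<eta>"
    by (metis not_le)
  obtain c s where c: "c \<in> X" "strict_mono (s :: nat \<Rightarrow> nat)" "(x \<circ> s) \<longlonglongrightarrow> c"
    using X xy(1) unfolding compact_def by metis
  have Tx: "(\<lambda>n. T (x (s n))) \<longlonglongrightarrow> T c"
    using continuous_on_tendsto_compose[OF cont c(3) c(1)] xy(1) by (simp add: comp_def)
  have "(\<lambda>n. 1 / real (Suc n)) \<longlonglongrightarrow> 0"
    using lim_inverse_n' by (rule LIMSEQ_Suc)
  from LIMSEQ_subseq_LIMSEQ[OF this c(2)] have gap: "(\<lambda>n. 1 / real (Suc (s n))) \<longlonglongrightarrow> 0"
    by (simp only: comp_def)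
  have "\<forall>n. norm (dist (y (s n)) (T (x (s n)))) \<le> 1 / real (Suc (s n))"
    by (simp add: less_imp_le[OF xy(3)] del: of_nat_Suc)
  from Lim_null_comparison[OF always_eventually[OF this] gap]
  have near: "(\<lambda>n. dist (y (s n)) (T (x (s n)))) \<longlonglongrightarrow> 0" .
  have "(\<lambda>n. dist (T (x (s n))) (T c)) \<longlonglongrightarrow> 0" using Tx by (rule tendsto_dist_iff[THEN iffD1])
  from tendsto_add_zero[OF near this]
  have sum: "(\<lambda>n. dist (y (s n)) (T (x (s n))) + dist (T (x (s n))) (T c)) \<longlonglongrightarrow> 0" .
  have "\<forall>n. norm (dist (y (s n)) (T c)) \<le> dist (y (s n)) (T (x (s n))) + dist (T (x (s n))) (T c)"
    by (simp add: dist_triangle)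
  from Lim_null_comparison[OF always_eventually[OF this] sum]
  have ylim: "(\<lambda>n. y (s n)) \<longlonglongrightarrow> T c" by (rule tendsto_dist_iff[THEN iffD2])
  have "openin (top_of_set X) (T ` (X \<inter> ball c (\<eta>/2)))"
    using op unfolding open_map_def by (meson open_ball openin_open_Int)
  then obtain O' where O': "open O'" "T ` (X \<inter> ball c (\<eta>/2)) = X \<inter> O'"
    unfolding openin_open by blast
  have "T c \<in> O'" using O' c(1) \<open>\<eta> > 0\<close> by (metis IntD2 IntI centre_in_ball half_gt_zero imageI)
  then have "\<forall>\<^sub>F n in sequentially. y (s n) \<in> O'" using ylim O'(1) topological_tendstoD by blast
  moreover have "\<forall>\<^sub>F n in sequentially. dist (x (s n)) c < \<eta>/2"
    using c(3) \<open>\<eta> > 0\<close> tendstoD[of "x \<circ> s" c sequentially "\<eta>/2"] by simp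
  ultimately have "\<forall>\<^sub>F n in sequentially. False"
  proof eventually_elim
    case (elim n)
    then have "y (s n) \<in> T ` (X \<inter> ball c (\<eta>/2))" using O' xy by blast
    then obtain w where w: "w \<in> X" "dist c w < \<eta>/2" "T w = y (s n)" by auto
    have "dist w (x (s n)) \<le> dist w c + dist (x (s n)) c" by (rule dist_triangle2)
    also have "\<dots> < \<eta>" using w elim by (simp add: dist_commute)
    finally show False using none[OF w(1,3)] by simp
  qed
  then show False by simp
qed

text \<open>
  Expansion is required up to distance \<open>2 * \<delta>\<close>, so that two orbits which both stay \<open>\<delta>\<close>-close
  to a third one can be compared with each other.
\<close>
locale expanding_with_branches =
  fixes X :: "'a::metric_space set" and T :: "'a \<Rightarrow> 'a" and l \<delta> :: real
  assumes compact: "compact X" and inv: "T ` X \<subseteq> X" and l: "1 < l" and \<delta>: "0 < \<delta>"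
    and expand: "\<And>x y. x \<in> X \<Longrightarrow> y \<in> X \<Longrightarrow> dist x y \<le> 2 * \<delta> \<Longrightarrow> l * dist x y \<le> dist (T x) (T y)"
    and branch: "\<And>x y. x \<in> X \<Longrightarrow> y \<in> X \<Longrightarrow> dist y (T x) < \<delta> \<Longrightarrow>
        \<exists>w\<in>X. T w = y \<and> dist w x \<le> dist y (T x) / l"

lemma open_expanding_map_branches:
  assumes "compact X" "open_expanding_map X T"
  obtains l \<delta> where "expanding_with_branches X T l \<delta>"
proof -
  obtain l \<eta> where T: "T ` X \<subseteq> X" "continuous_on X T" "open_map (top_of_set X) (top_of_set X) T"
    and l: "l > 1" and \<eta>: "\<eta> > 0"
    and ex: "\<And>x y. x \<in> X \<Longrightarrow> y \<in> X \<Longrightarrow> dist x y \<le> \<eta> \<Longrightarrow> l * dist x y \<le> dist (T x) (T y)"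
    using assms(2) unfolding open_expanding_map_def by blast
  obtain \<delta>0 where \<delta>0: "\<delta>0 > 0"
    "\<And>x y. x \<in> X \<Longrightarrow> y \<in> X \<Longrightarrow> dist y (T x) < \<delta>0 \<Longrightarrow> \<exists>w\<in>X. T w = y \<and> dist w x \<le> \<eta>"
    using uniform_local_surjectivity[OF assms(1) T \<eta>] by metis
  define \<delta> where "\<delta> = min \<delta>0 (\<eta> / 2)"
  have "expanding_with_branches X T l \<delta>"
  proof
    show "\<exists>w\<in>X. T w = y \<and> dist w x \<le> dist y (T x) / l"
      if xy: "x \<in> X" "y \<in> X" "dist y (T x) < \<delta>" for x y
    proof -
      obtain w where w: "w \<in> X" "T w = y" "dist w x \<le> \<eta>"
        using \<delta>0(2)[OF xy(1,2)] xy(3) by (auto simp: \<delta>_def)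
      have "l * dist w x \<le> dist y (T x)" using ex[OF w(1) xy(1) w(3)] w(2) by simp
      then show ?thesis using w l by (auto simp: field_simps)
    qed
    show "0 < \<delta>" using \<delta>0(1) \<eta> by (simp add: \<delta>_def)
    show "l * dist x y \<le> dist (T x) (T y)" if "x \<in> X" "y \<in> X" "dist x y \<le> 2 * \<delta>" for x y
      using that by (intro ex) (simp_all add: \<delta>_def min_def split: if_splits)
  qed (rule assms T l)+
  then show thesis by (rule that)
qed

context expanding_with_branches
begin

lemma orbit_in [simp]: "x \<in> X \<Longrightarrow> (T ^^ n) x \<in> X"
  using inv by (rule funpow_in_invariant_set)

text \<open>
  Applying inverse branches backwards along an orbit segment of \<open>a\<close> never leaves their domain,
  since each step divides the distance to that orbit by at least \<open>l\<close>.
\<close>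
lemma lift_orbit:
  assumes "a \<in> X" "z \<in> X" "dist z ((T ^^ n) a) < \<delta>"
  shows "\<exists>w\<in>X. (T ^^ n) w = z \<and>
    (\<forall>k\<le>n. dist ((T ^^ k) w) ((T ^^ k) a) \<le> dist z ((T ^^ n) a) / l ^ (n - k))"
  using assms(2,3)
proof (induction n arbitrary: z)
  case 0
  then show ?case by auto
next
  case (Suc n)
  obtain z' where z': "z' \<in> X" "T z' = z" "dist z' ((T ^^ n) a) \<le> dist z ((T ^^ Suc n) a) / l"
    using branch[of "(T ^^ n) a" z] assms(1) Suc.prems by auto
  have "dist z ((T ^^ Suc n) a) / l \<le> dist z ((T ^^ Suc n) a)"
    using l by (simp add: divide_le_eq mult_le_cancel_left1 del: funpow.simps)
  then have "dist z' ((T ^^ n) a) < \<delta>" using z'(3) Suc.prems(2) by linarith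
  then obtain w where w: "w \<in> X" "(T ^^ n) w = z'"
    "\<And>k. k \<le> n \<Longrightarrow> dist ((T ^^ k) w) ((T ^^ k) a) \<le> dist z' ((T ^^ n) a) / l ^ (n - k)"
    using Suc.IH[OF z'(1)] by blast
  have "dist ((T ^^ k) w) ((T ^^ k) a) \<le> dist z ((T ^^ Suc n) a) / l ^ (Suc n - k)" if "k \<le> Suc n" for k
  proof (cases "k = Suc n")
    case True
    then show ?thesis using w z' by simp
  next
    case False
    then have k: "k \<le> n" using that by simp
    have "dist ((T ^^ k) w) ((T ^^ k) a) \<le> dist z' ((T ^^ n) a) / l ^ (n - k)" using w(3)[OF k] .
    also have "\<dots> \<le> dist z ((T ^^ Suc n) a) / l / l ^ (n - k)"
      using z'(3) l by (intro divide_right_mono) auto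
    also have "\<dots> = dist z ((T ^^ Suc n) a) / l ^ (Suc n - k)"
      using k by (simp add: Suc_diff_le del: funpow.simps)
    finally show ?thesis .
  qed
  then show ?case using w z' by (intro bexI[of _ w]) auto
qed

lemma expand_orbit:
  assumes "x \<in> X" "y \<in> X" "\<And>k. k < n \<Longrightarrow> dist ((T ^^ k) x) ((T ^^ k) y) \<le> 2 * \<delta>"
  shows "l ^ n * dist x y \<le> dist ((T ^^ n) x) ((T ^^ n) y)"
  using assms(3)
proof (induction n)
  case (Suc n)
  have "l ^ Suc n * dist x y = l * (l ^ n * dist x y)" by simp
  also have "\<dots> \<le> l * dist ((T ^^ n) x) ((T ^^ n) y)"
    using Suc l by (intro mult_left_mono) auto
  also have "\<dots> \<le> dist ((T ^^ Suc n) x) ((T ^^ Suc n) y)"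
    using expand[of "(T ^^ n) x" "(T ^^ n) y"] assms Suc.prems by simp
  finally show ?case .
qed simp

text \<open>
  If an orbit segment nearly returns to its start \<open>a\<close>, then pulling points back along the segment
  maps the ball of radius \<open>\<delta> / 2\<close> around \<open>a\<close> into itself: a point of that ball is within
  \<open>\<delta> / 2 + \<epsilon>\<close> of the end of the segment, and the pull-back divides this distance by at least \<open>l\<close>,
  which beats the gap \<open>\<epsilon>\<close> as soon as \<open>\<epsilon> \<le> (l - 1) * (\<delta> / 2)\<close>. The pull-back is a contraction,
  and its fixed point is periodic and shadows the segment.
\<close>
lemma closing:
  assumes a: "a \<in> X" and m: "m > 0"
    and \<epsilon>: "\<epsilon> < \<delta> / 2" "\<epsilon> \<le> (l - 1) * (\<delta> / 2)" and ret: "dist a ((T ^^ m) a) \<le> \<epsilon>"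
  obtains p where "p \<in> X" "(T ^^ m) p = p"
    "\<And>k. k \<le> m \<Longrightarrow> dist ((T ^^ k) p) ((T ^^ k) a) \<le> \<delta> / l ^ (m - k)"
proof -
  define S where "S = X \<inter> cball a (\<delta> / 2)"
  have "compact S" unfolding S_def using compact by (simp add: compact_Int_closed)
  have l1: "1 \<le> l ^ j" for j using l by simp
  have lm: "l \<le> l ^ m" using l m by (simp add: self_le_power)
  have end_near: "dist z ((T ^^ m) a) \<le> \<delta> / 2 + \<epsilon>" if "z \<in> S" for z
  proof -
    have "dist a z \<le> \<delta> / 2" using that by (simp add: S_def)
    then show ?thesis using dist_triangle[of z "(T ^^ m) a" a] ret by (simp add: dist_commute)
  qed
  have "\<exists>w\<in>X. (T ^^ m) w = z \<and>
      (\<forall>k\<le>m. dist ((T ^^ k) w) ((T ^^ k) a) \<le> dist z ((T ^^ m) a) / l ^ (m - k))" if "z \<in> S" for z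
    using end_near[OF that] \<epsilon>(1) that a by (intro lift_orbit) (auto simp: S_def)
  then obtain \<phi> where \<phi>: "\<And>z. z \<in> S \<Longrightarrow> \<phi> z \<in> X" "\<And>z. z \<in> S \<Longrightarrow> (T ^^ m) (\<phi> z) = z"
    "\<And>z k. z \<in> S \<Longrightarrow> k \<le> m \<Longrightarrow> dist ((T ^^ k) (\<phi> z)) ((T ^^ k) a) \<le> dist z ((T ^^ m) a) / l ^ (m - k)"
    by metis
  have shadow: "dist ((T ^^ k) (\<phi> z)) ((T ^^ k) a) \<le> \<delta> / l ^ (m - k)" if "z \<in> S" "k \<le> m" for z k
  proof -
    have "dist z ((T ^^ m) a) / l ^ (m - k) \<le> \<delta> / l ^ (m - k)"
      using end_near[OF that(1)] \<epsilon>(1) l by (intro divide_right_mono) auto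
    then show ?thesis using \<phi>(3)[OF that] by linarith
  qed
  have shadow': "dist ((T ^^ k) (\<phi> z)) ((T ^^ k) a) \<le> \<delta>" if "z \<in> S" "k \<le> m" for z k
  proof -
    have "\<delta> * 1 \<le> \<delta> * l ^ (m - k)" using l1[of "m - k"] \<delta> by (intro mult_left_mono) simp_all
    then have "\<delta> / l ^ (m - k) \<le> \<delta>" using l by (simp add: divide_le_eq)
    then show ?thesis using shadow[OF that] by linarith
  qed
  have "\<phi> ` S \<subseteq> S"
  proof
    fix w assume "w \<in> \<phi> ` S"
    then obtain z where z: "z \<in> S" "w = \<phi> z" by blast
    have "dist w a \<le> dist z ((T ^^ m) a) / l ^ m" using \<phi>(3)[OF z(1), of 0] z(2) by simp
    also have "\<dots> \<le> dist z ((T ^^ m) a) / l" using lm l by (intro divide_left_mono) auto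
    also have "\<dots> \<le> (\<delta> / 2 + \<epsilon>) / l" using end_near[OF z(1)] l by (intro divide_right_mono) auto
    also have "\<dots> \<le> \<delta> / 2" using \<epsilon>(2) l by (simp add: field_simps)
    finally show "w \<in> S" using \<phi>(1)[OF z(1)] z(2) by (simp add: S_def dist_commute)
  qed
  moreover have "dist (\<phi> z) (\<phi> z') \<le> 1 / l * dist z z'" if "z \<in> S" "z' \<in> S" for z z'
  proof -
    have "l ^ m * dist (\<phi> z) (\<phi> z') \<le> dist ((T ^^ m) (\<phi> z)) ((T ^^ m) (\<phi> z'))"
    proof (rule expand_orbit)
      fix k assume "k < m"
      then show "dist ((T ^^ k) (\<phi> z)) ((T ^^ k) (\<phi> z')) \<le> 2 * \<delta>"
        using shadow'[OF that(1), of k] shadow'[OF that(2), of k]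
          dist_triangle2[of "(T ^^ k) (\<phi> z)" "(T ^^ k) (\<phi> z')" "(T ^^ k) a"] by simp
    qed (use \<phi>(1) that in auto)
    then have "l ^ m * dist (\<phi> z) (\<phi> z') \<le> dist z z'" using \<phi>(2) that by simp
    moreover have "l * dist (\<phi> z) (\<phi> z') \<le> l ^ m * dist (\<phi> z) (\<phi> z')"
      using lm by (intro mult_right_mono) auto
    ultimately show ?thesis using l by (simp add: field_simps)
  qed
  moreover have "S \<noteq> {}" using a \<delta> by (auto simp: S_def)
  ultimately have "\<exists>!p\<in>S. \<phi> p = p"
    using l by (intro Banach_fix[OF compact_imp_complete[OF \<open>compact S\<close>], of "1 / l"]) auto
  then obtain p where p: "p \<in> S" "\<phi> p = p" by blast
  show thesis using that[of p] p \<phi>(1,2)[OF p(1)] shadow[OF p(1)] by simp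
qed

end

section \<open>Periodic orbits and the maximum ergodic average\<close>

text \<open>
  The image of the uniform distribution on the index set rather than on the points of the orbit:
  this is the right weighting also when \<open>m\<close> is a proper multiple of the minimal period.
\<close>
definition periodic_orbit_measure :: "'a::metric_space set \<Rightarrow> ('a \<Rightarrow> 'a) \<Rightarrow> nat \<Rightarrow> 'a \<Rightarrow> 'a measure" where
  "periodic_orbit_measure X T m p =
     distr (measure_pmf (pmf_of_set {..<m})) (restrict_space borel X) (\<lambda>i. (T ^^ i) p)"

lemma periodic_orbit_measure_invariant:
  assumes inv: "T ` X \<subseteq> X" and cont: "continuous_on X T"
    and p: "p \<in> X" "(T ^^ m) p = p" and m: "m > 0"
  shows "periodic_orbit_measure X T m p \<in> invariant_prob_measures X T"
proof -
  define U where "U = pmf_of_set {..<m}"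
  define N where "N = restrict_space borel X"
  define orb where "orb i = (T ^^ i) p" for i
  have orb: "orb \<in> measure_pmf U \<rightarrow>\<^sub>M N"
    by (auto simp: N_def orb_def space_restrict_space measurable_def funpow_in_invariant_set[OF inv p(1)])
  have M: "periodic_orbit_measure X T m p = distr (measure_pmf U) N orb"
    by (simp add: periodic_orbit_measure_def U_def N_def orb_def[abs_def])
  have T: "T \<in> N \<rightarrow>\<^sub>M N"
    unfolding N_def
    using inv borel_measurable_continuous_on_restrict[OF cont]
    by (intro measurable_restrict_space2) (auto simp: space_restrict_space)
  define r where "r i = Suc i mod m" for i
  have "inj_on r {..<m}"
    by (auto simp: inj_on_def r_def mod_Suc split: if_splits)
  moreover have "r ` {..<m} \<subseteq> {..<m}" using m by (auto simp: r_def)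
  ultimately have "r ` {..<m} = {..<m}"
    by (simp add: endo_inj_surj)
  then have rU: "map_pmf r U = U"
    using map_pmf_of_set_inj[OF \<open>inj_on r {..<m}\<close>] m by (auto simp: U_def lessThan_empty_iff)
  \<comment> \<open>By periodicity, \<open>T\<close> acts on the orbit as the cyclic shift acts on the indices.\<close>
  have shift: "T (orb i) = orb (r i)" for i
  proof -
    have "(T ^^ (Suc i mod m)) p = (T ^^ Suc i) p" using p(2) by (rule funpow_mod_eq)
    then show ?thesis by (simp add: orb_def r_def)
  qed
  have "distr (distr (measure_pmf U) N orb) N T = distr (measure_pmf U) N (T \<circ> orb)"
    using T orb by (simp add: distr_distr)
  also have "\<dots> = distr (measure_pmf U) N (orb \<circ> r)"
    by (simp add: comp_def shift)
  also have "\<dots> = distr (distr (measure_pmf U) (count_space UNIV) r) N orb"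
    using orb by (subst distr_distr) auto
  also have "distr (measure_pmf U) (count_space UNIV) r = measure_pmf U"
    using rU by (metis map_pmf_rep_eq)
  finally have eq: "distr (distr (measure_pmf U) N orb) N T = distr (measure_pmf U) N orb" .
  have "distr (distr (measure_pmf U) N orb) (distr (measure_pmf U) N orb) T
      = distr (distr (measure_pmf U) N orb) N T"
    by (rule distr_cong) auto
  with eq show ?thesis
    unfolding invariant_prob_measures_def M
    using orb T by (auto simp: N_def[symmetric] intro!: measure_pmf.prob_space_distr)
qed

lemma integral_periodic_orbit_measure:
  assumes inv: "T ` X \<subseteq> X" and f: "continuous_on X f" and p: "p \<in> X" and m: "m > 0"
  shows "integral\<^sup>L (periodic_orbit_measure X T m p) f = birkhoff_sum T f m p / real m"
proof -
  have "integral\<^sup>L (periodic_orbit_measure X T m p) f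
      = integral\<^sup>L (measure_pmf (pmf_of_set {..<m})) (\<lambda>i. f ((T ^^ i) p))"
    unfolding periodic_orbit_measure_def
    by (intro integral_distr borel_measurable_continuous_on_restrict f)
      (auto simp: space_restrict_space measurable_def funpow_in_invariant_set[OF inv p])
  also have "\<dots> = birkhoff_sum T f m p / real m"
    using m by (subst integral_pmf_of_set) (auto simp: birkhoff_sum_def)
  finally show ?thesis .
qed

lemma birkhoff_sum_periodic_le_max_ergodic_average:
  assumes X: "compact X" and inv: "T ` X \<subseteq> X" and cont: "continuous_on X T" "continuous_on X f"
    and p: "p \<in> X" "(T ^^ m) p = p" and m: "m > 0"
  shows "birkhoff_sum T f m p \<le> real m * max_ergodic_average X T f"
proof -
  obtain B where B: "\<And>x. x \<in> X \<Longrightarrow> \<bar>f x\<bar> \<le> B"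
    using compact_imp_bounded[OF compact_continuous_image[OF cont(2) X]]
    by (auto simp: bounded_iff)
  have "B \<ge> 0" using B[OF p(1)] by simp
  \<comment> \<open>The supremum of an unbounded set of reals would be an unspecified value.\<close>
  have "bdd_above ((\<lambda>M. integral\<^sup>L M f) ` invariant_prob_measures X T)"
  proof (rule bdd_aboveI2)
    fix M assume "M \<in> invariant_prob_measures X T"
    then have M: "prob_space M" "sets M = sets (restrict_space borel X)"
      by (auto simp: invariant_prob_measures_def)
    have "space M = X" using sets_eq_imp_space_eq[OF M(2)] by (simp add: space_restrict_space)
    interpret prob_space M by fact
    show "integral\<^sup>L M f \<le> B"
    proof (cases "integrable M f")
      case True
      then show ?thesis
        by (rule integral_le_const) (use B \<open>space M = X\<close> in \<open>auto simp: abs_le_iff intro!: AE_I2\<close>)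
    next
      case False
      then show ?thesis using \<open>B \<ge> 0\<close> by (simp add: not_integrable_integral_eq)
    qed
  qed
  then have "integral\<^sup>L (periodic_orbit_measure X T m p) f \<le> max_ergodic_average X T f"
    unfolding max_ergodic_average_def
    using periodic_orbit_measure_invariant[OF inv cont(1) p m] by (intro cSUP_upper)
  then show ?thesis
    using m by (simp add: integral_periodic_orbit_measure[OF inv cont(2) p(1) m] field_simps)
qed

section \<open>Bounded Birkhoff sums and the sub-action\<close>

text \<open>
  By shadowing with a periodic orbit, the sum over a near return exceeds that of the periodic
  orbit by at most the distortion constant, and the latter sum is nonpositive. Cells of diameter
  at most \<open>\<epsilon>\<close> reduce arbitrary segments to near returns.
\<close>
lemma (in expanding_with_branches) birkhoff_sums_bounded_above:
  assumes cont: "continuous_on X T" and \<alpha>: "0 < \<alpha>" and f: "holder_on \<alpha> X f"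
  obtains L where "\<And>n x. x \<in> X \<Longrightarrow>
    birkhoff_sum T (\<lambda>z. f z - max_ergodic_average X T f) n x \<le> L"
proof -
  define \<beta> where "\<beta> = max_ergodic_average X T f"
  obtain K where K0: "K > 0" and K: "\<And>z z'. z \<in> X \<Longrightarrow> z' \<in> X \<Longrightarrow> \<bar>f z - f z'\<bar> \<le> K * dist z z' powr \<alpha>"
    using f unfolding holder_on_def by blast
  have cf: "continuous_on X f" using \<alpha> f by (rule holder_on_imp_continuous_on)
  obtain B0 where B0: "\<And>x. x \<in> X \<Longrightarrow> \<bar>f x\<bar> \<le> B0"
    using compact_imp_bounded[OF compact_continuous_image[OF cf compact]] by (auto simp: bounded_iff)
  define B where "B = \<bar>B0\<bar> + \<bar>\<beta>\<bar>"
  have B: "B \<ge> 0" "\<And>x. x \<in> X \<Longrightarrow> f x - \<beta> \<le> B" unfolding B_def using B0 by force+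
  define C where "C = K / (1 - l powr (- \<alpha>)) * \<delta> powr \<alpha>"
  have "l powr (- \<alpha>) < 1" using l \<alpha> by (simp add: powr_less_one)
  then have C: "C \<ge> 0" using K0 by (simp add: C_def)
  define \<epsilon> where "\<epsilon> = min (\<delta> / 4) ((l - 1) * (\<delta> / 2))"
  have \<epsilon>: "\<epsilon> > 0" "\<epsilon> < \<delta> / 2" "\<epsilon> \<le> (l - 1) * (\<delta> / 2)" using l \<delta> by (auto simp: \<epsilon>_def)
  have return: "birkhoff_sum T (\<lambda>z. f z - \<beta>) m x \<le> C"
    if x: "x \<in> X" "dist x ((T ^^ m) x) \<le> \<epsilon>" and m: "m > 0" for x m
  proof -
    obtain p where p: "p \<in> X" "(T ^^ m) p = p"
      "\<And>k. k \<le> m \<Longrightarrow> dist ((T ^^ k) p) ((T ^^ k) x) \<le> \<delta> / l ^ (m - k)"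
      using closing[OF x(1) m \<epsilon>(2,3) x(2)] by metis
    have "birkhoff_sum T f m x \<le> birkhoff_sum T f m p + C"
      unfolding C_def
      by (rule birkhoff_sum_distortion[OF l \<alpha> _ _ inv x(1) p(1) K])
        (use K0 \<delta> p(3) in \<open>auto simp: dist_commute\<close>)
    moreover have "birkhoff_sum T f m p \<le> real m * \<beta>"
      unfolding \<beta>_def
      by (rule birkhoff_sum_periodic_le_max_ergodic_average[OF compact inv cont cf p(1,2) m])
    ultimately show ?thesis by (simp add: birkhoff_sum_diff_const)
  qed
  obtain P where P: "finite P" "X \<subseteq> (\<Union>c\<in>P. ball c (\<epsilon> / 2))"
    using compact \<epsilon>(1) unfolding compact_eq_totally_bounded by (meson half_gt_zero)
  define \<U> where "\<U> = (\<lambda>c. ball c (\<epsilon> / 2)) ` P"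
  have "birkhoff_sum T (\<lambda>z. f z - \<beta>) n x \<le> real (card \<U>) * (C + B)" if "x \<in> X" for n x
  proof (rule birkhoff_sum_le_card_cells[OF inv B C])
    show "finite \<U>" using P by (simp add: \<U>_def)
    show "birkhoff_sum T (\<lambda>z. f z - \<beta>) m y \<le> C"
      if "U \<in> \<U>" "y \<in> X" "y \<in> U" "(T ^^ m) y \<in> U" "m > 0" for U y m
    proof (rule return)
      obtain c where "dist c y < \<epsilon> / 2" "dist c ((T ^^ m) y) < \<epsilon> / 2"
        using \<open>U \<in> \<U>\<close> \<open>y \<in> U\<close> \<open>(T ^^ m) y \<in> U\<close> by (auto simp: \<U>_def)
      then show "dist y ((T ^^ m) y) \<le> \<epsilon>" using dist_triangle3[of y "(T ^^ m) y" c] by simp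
    qed (use that in auto)
    show "(T ^^ k) x \<in> \<Union>\<U>" if "k < n" for k
      using P(2) orbit_in[OF \<open>x \<in> X\<close>, of k] unfolding \<U>_def by blast
  qed (use that in auto)
  then show thesis unfolding \<beta>_def by (rule that)
qed

text \<open>
  The function is \<open>v x = sup {S\<^sub>n g y | T\<^sup>n y = x}\<close>. For points at distance less than \<open>\<delta>\<close> the
  Hoelder estimate comes from lifting orbit segments; for the other pairs it is a consequence of
  \<open>0 \<le> v \<le> L\<close>, the lower bound being the term with \<open>n = 0\<close>.
\<close>
lemma (in expanding_with_branches) bounded_birkhoff_sums_imp_holder_subaction:
  assumes \<alpha>: "0 < \<alpha>" and g: "holder_on \<alpha> X g"
    and L: "\<And>n x. x \<in> X \<Longrightarrow> birkhoff_sum T g n x \<le> L"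
  shows "\<exists>v. holder_on \<alpha> X v \<and> (\<forall>x\<in>X. g x + v x \<le> v (T x))"
proof -
  obtain K where K0: "K > 0" and K: "\<And>z z'. z \<in> X \<Longrightarrow> z' \<in> X \<Longrightarrow> \<bar>g z - g z'\<bar> \<le> K * dist z z' powr \<alpha>"
    using g unfolding holder_on_def by blast
  define C where "C = K / (1 - l powr (- \<alpha>))"
  have "l powr (- \<alpha>) < 1" using l \<alpha> by (simp add: powr_less_one)
  then have C: "C > 0" using K0 by (simp add: C_def)
  define A where "A x = {birkhoff_sum T g n y | n y. y \<in> X \<and> (T ^^ n) y = x}" for x
  define v where "v x = Sup (A x)" for x
  have bdd: "bdd_above (A x)" for x by (rule bdd_aboveI[of _ L]) (auto simp: A_def L)
  have zero: "0 \<in> A x" if "x \<in> X" for x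
    using that unfolding A_def by (force intro: exI[of _ "0::nat"])
  have upper: "birkhoff_sum T g n y \<le> v ((T ^^ n) y)" if "y \<in> X" for n y
    unfolding v_def by (intro cSup_upper bdd) (use that in \<open>auto simp: A_def\<close>)
  have least: "v x \<le> b" if "x \<in> X" "\<And>n y. y \<in> X \<Longrightarrow> (T ^^ n) y = x \<Longrightarrow> birkhoff_sum T g n y \<le> b" for x b
    unfolding v_def by (intro cSup_least) (use that(2) zero[OF that(1)] in \<open>auto simp: A_def\<close>)
  have v: "0 \<le> v x" "v x \<le> L" if "x \<in> X" for x
    using upper[OF that, of 0] least[OF that, of L] L by auto
  have "g x + v x \<le> v (T x)" if x: "x \<in> X" for x
  proof -
    have "v x \<le> v (T x) - g x"
    proof (rule least[OF x])
      fix n y assume "y \<in> X" "(T ^^ n) y = x"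
      then show "birkhoff_sum T g n y \<le> v (T x) - g x"
        using upper[of y "Suc n"] by (simp add: birkhoff_sum_Suc)
    qed
    then show ?thesis by simp
  qed
  moreover have "holder_on \<alpha> X v"
  proof -
    define H where "H = C + \<bar>L\<bar> / \<delta> powr \<alpha>"
    have H: "H > 0" using C by (simp add: H_def add_pos_nonneg)
    have half: "v x \<le> v x' + H * dist x x' powr \<alpha>" if x: "x \<in> X" "x' \<in> X" for x x'
    proof (cases "dist x x' < \<delta>")
      case True
      have "v x \<le> v x' + C * dist x x' powr \<alpha>"
      proof (rule least[OF x(1)])
        fix n y assume y: "y \<in> X" "(T ^^ n) y = x"
        obtain w where w: "w \<in> X" "(T ^^ n) w = x'"
          "\<And>k. k \<le> n \<Longrightarrow> dist ((T ^^ k) w) ((T ^^ k) y) \<le> dist x' x / l ^ (n - k)"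
          using lift_orbit[OF y(1) x(2), of n] True y(2) by (auto simp: dist_commute)
        have "birkhoff_sum T g n y \<le> birkhoff_sum T g n w + C * dist x x' powr \<alpha>"
          unfolding C_def
          by (rule birkhoff_sum_distortion[OF l \<alpha> _ _ inv y(1) w(1) K])
            (use K0 w(3) in \<open>auto simp: dist_commute\<close>)
        then show "birkhoff_sum T g n y \<le> v x' + C * dist x x' powr \<alpha>"
          using upper[OF w(1), of n] w(2) by simp
      qed
      also have "\<dots> \<le> v x' + H * dist x x' powr \<alpha>"
        by (intro add_left_mono mult_right_mono) (auto simp: H_def)
      finally show ?thesis .
    next
      case False
      have "v x \<le> \<bar>L\<bar>" using v(2)[OF x(1)] by simp
      also have "\<dots> = \<bar>L\<bar> / \<delta> powr \<alpha> * \<delta> powr \<alpha>" using \<delta> by simp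
      also have "\<dots> \<le> H * dist x x' powr \<alpha>"
        using False \<delta> \<alpha> C by (intro mult_mono powr_mono2) (auto simp: H_def)
      finally show ?thesis using v(1)[OF x(2)] by simp
    qed
    have "\<bar>v x - v x'\<bar> \<le> H * dist x x' powr \<alpha>" if "x \<in> X" "x' \<in> X" for x x'
      using half[OF that] half[OF that(2,1)] by (simp add: dist_commute)
    then show ?thesis unfolding holder_on_def using H by blast
  qed
  ultimately show ?thesis by blast
qed

theorem corollary6p4:
  fixes X :: "'a::metric_space set" and T :: "'a \<Rightarrow> 'a" and f :: "'a \<Rightarrow> real" and \<alpha> :: real
  assumes "compact X"
    and "open_expanding_map X T"
    and "0 < \<alpha>" and "\<alpha> \<le> 1"
    and "holder_on \<alpha> X f"
  shows "\<exists>v :: 'a \<Rightarrow> real. holder_on \<alpha> X v \<and>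
           (\<forall>x\<in>X. f x + v x - v (T x) \<le> max_ergodic_average X T f)"
proof -
  obtain l \<delta> where "expanding_with_branches X T l \<delta>"
    using open_expanding_map_branches[OF assms(1,2)] .
  then interpret expanding_with_branches X T l \<delta> .
  define g where "g x = f x - max_ergodic_average X T f" for x
  have "continuous_on X T" using assms(2) by (simp add: open_expanding_map_def)
  then obtain L where "\<And>n x. x \<in> X \<Longrightarrow> birkhoff_sum T g n x \<le> L"
    using birkhoff_sums_bounded_above[OF _ assms(3,5)] unfolding g_def by metis
  moreover have "holder_on \<alpha> X g" using assms(5) by (simp add: holder_on_def g_def)
  ultimately obtain v where "holder_on \<alpha> X v" "\<And>x. x \<in> X \<Longrightarrow> g x + v x \<le> v (T x)"
    using bounded_birkhoff_sums_imp_holder_subaction[OF assms(3)] by blast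
  then show ?thesis by (force simp: g_def)
qed

end
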